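(* Let $Z$ be an exponential random variable with mean $1$. Let $W\ge 0$ be a random variable with finite second moment and let $(W,W_t)_{t>0}$ be a family of exchangeable pairs defined on a common probability space. Let $F$ be a $\sigma$-algebra such that $\sigma(W)\subseteq F$, let $\Lambda>0$ be a constant, and suppose there are $F$-measurable random variables $E$ and $E'$ such that 1. $\mathbb{E}[W_t-W\mid F]=\Lambda t(1-W)+tE+O(t^2)$; 2. $\mathbb{E}[(W_t-W)^2\mid F]=2\Lambda tW+tE'+O(t^2)$; 3. for each $\rho>0$, $\displaystyle\lim_{t\to0}\frac1t\,\mathbb{E}\big[|W_t-W|^2\,\mathbb{I}(|W_t-W|^2>\rho)\big]=0$. Then, for every $\delta>0$, $$d_K(W,Z)\le\frac{1}{\Lambda\delta}\left[2\,\mathbb{E}|E'|+\Big(1+\frac2e\Big)\mathbb{E}|E|\right]+\frac{\delta}{2}.$$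
   Context: A pair $(X,X')$ of random variables on a common probability space is exchangeable if $(X,X')$ and $(X',X)$ have the same distribution. $\mathbb{I}(\cdot)$ denotes an indicator. $O(t^2)$ denotes a random error term bounded in absolute value by $Ct^2$ for all sufficiently small $t>0$, with a deterministic constant $C$. The Kolmogorov distance is $d_K(X,Y)=\sup_{s\in\mathbb{R}}|\mathbb{P}(X\le s)-\mathbb{P}(Y\le s)|$. *)

theory Defs
  imports "HOL-Probability.Probability"
begin

definition exchangeable_pair :: "'a measure \<Rightarrow> ('a \<Rightarrow> real) \<Rightarrow> ('a \<Rightarrow> real) \<Rightarrow> bool" where
  "exchangeable_pair M X X' \<longleftrightarrow>
     X \<in> borel_measurable M \<and> X' \<in> borel_measurable M \<and>
     distr M (borel \<Otimes>\<^sub>M borel) (\<lambda>\<omega>. (X \<omega>, X' \<omega>)) =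
     distr M (borel \<Otimes>\<^sub>M borel) (\<lambda>\<omega>. (X' \<omega>, X \<omega>))"

text \<open>
  The random variables \<open>X\<close> and \<open>Y\<close> may live on different probability spaces.
\<close>

definition kolmogorov_dist ::
    "'a measure \<Rightarrow> ('a \<Rightarrow> real) \<Rightarrow> 'b measure \<Rightarrow> ('b \<Rightarrow> real) \<Rightarrow> real" where
  "kolmogorov_dist M X N Y =
     (SUP s\<in>(UNIV :: real set). \<bar>\<P>(\<omega> in M. X \<omega> \<le> s) - \<P>(\<omega> in N. Y \<omega> \<le> s)\<bar>)"

text \<open>
  The random error term \<open>O(t\<^sup>2)\<close>: the constant \<open>C\<close> is deterministic and does not depend on \<open>t\<close>.
  The bound holds almost surely for each small \<open>t\<close>, because for each \<open>t\<close> a conditional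
  expectation is only determined up to a null set.
\<close>

definition random_bigo_sq :: "'a measure \<Rightarrow> (real \<Rightarrow> 'a \<Rightarrow> real) \<Rightarrow> bool" where
  "random_bigo_sq M R \<longleftrightarrow>
     (\<exists>C::real. \<forall>\<^sub>F t in at_right 0. AE \<omega> in M. \<bar>R t \<omega>\<bar> \<le> C * t\<^sup>2)"

end

theory Submission imports Defs begin

text \<open>
  The proof is Stein's method for the exponential law, whose Stein operator is
  \<open>w * g' w + (1 - w) * g w\<close>. For a differentiable \<open>g\<close> with Lipschitz derivative, exchangeability gives
  \<open>\<E> [(Wt - W) * (g W + g Wt)] = 0\<close>. Expanding \<open>g Wt\<close> around \<open>W\<close>, conditioning on \<open>F\<close>, dividing
  by \<open>t\<close> and letting \<open>t \<rightarrow> 0\<close> yields (\<open>generator_identity\<close>)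

    \<open>\<Lambda> * \<E> [W * g' W + (1 - W) * g W] = - \<E> [g W * E + g' W * E' / 2]\<close>.

  To compare distribution functions, the indicator of \<open>{..s}\<close> is placed between two ramps of
  slope \<open>- 1 / \<delta>\<close>. Since the exponential density is at most \<open>1\<close>, replacing the indicator by a
  ramp costs at most \<open>\<delta> / 2\<close> under \<open>Z\<close>. A ramp is, up to a constant, a difference of two stop-loss functions
  \<open>max (w - a) 0\<close>, divided by \<open>\<delta>\<close>, so the Stein equation has to be solved only for stop-loss
  functions. There the solution is explicit (\<open>exponential_stein_solution\<close>): both \<open>g\<close> and \<open>g'\<close>
  take values in \<open>{-1..0}\<close>, and \<open>g'\<close> is Lipschitz, which is the smoothness that the expansion
  needs. For a difference of two such solutions, \<open>g\<close> and \<open>g'\<close> are therefore at most \<open>1\<close> in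
  absolute value, and the distribution functions differ by at most
  \<open>(\<E> \<bar>E\<bar> + \<E> \<bar>E'\<bar> / 2) / (\<Lambda> * \<delta>) + \<delta> / 2\<close> (\<open>cdf_bound\<close>), which implies the claim.
\<close>

section \<open>The Stein equation of the exponential law\<close>

text \<open>
  \<open>exp_moment 0\<close> is the entire function \<open>(exp w - 1) / w\<close>; the moment \<open>n\<close> is its \<open>n\<close>-th
  derivative. The integral form needs no case distinction at \<open>w = 0\<close>, which matters because
  \<open>W\<close> may have an atom there.
\<close>

definition exp_moment :: "nat \<Rightarrow> real \<Rightarrow> real" where
  "exp_moment n w = integral {0..1} (\<lambda>u. u ^ n * exp (w * u))"

lemma exp_moment_integrable: "(\<lambda>u::real. u ^ n * exp (w * u)) integrable_on {0..1}"
  by (intro integrable_continuous_interval continuous_intros)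

lemma exp_moment_has_real_derivative:
  "(exp_moment n has_real_derivative exp_moment (Suc n) w) (at w)"
proof -
  have "((\<lambda>w. integral (cbox 0 1) (\<lambda>u::real. u ^ n * exp (w * u))) has_real_derivative
          integral (cbox 0 1) (\<lambda>u. u ^ Suc n * exp (w * u))) (at w within UNIV)"
  proof (rule leibniz_rule_field_derivative[where U = UNIV])
    fix x t :: real
    show "((\<lambda>x. t ^ n * exp (x * t)) has_field_derivative t ^ Suc n * exp (x * t)) (at x within UNIV)"
      by (auto intro!: derivative_eq_intros)
  next
    fix x :: real
    show "(\<lambda>u::real. u ^ n * exp (x * u)) integrable_on cbox 0 1"
      using exp_moment_integrable by (simp add: cbox_interval)
  next
    show "continuous_on (UNIV \<times> cbox 0 1) (\<lambda>(x, t). t ^ Suc n * exp (x * t :: real))"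
      by (auto intro!: continuous_intros simp: split_beta)
  qed auto
  then show ?thesis
    by (simp add: exp_moment_def[abs_def] cbox_interval)
qed

lemma exp_moment_0: "w * exp_moment 0 w = exp w - 1"
proof -
  have "((\<lambda>u. w * exp (w * u)) has_integral (exp (w * 1) - exp (w * 0))) {0..1}"
    by (rule fundamental_theorem_of_calculus)
       (auto intro!: derivative_eq_intros simp: has_real_derivative_iff_has_vector_derivative[symmetric])
  from integral_unique[OF this] show ?thesis
    by (simp add: exp_moment_def)
qed

text \<open>
  Integration by parts, from the derivative of \<open>u ^ (n + 1) * exp (w * u)\<close> in \<open>u\<close>.
\<close>

lemma exp_moment_Suc: "w * exp_moment (Suc n) w = exp w - Suc n * exp_moment n w"
proof -
  have "((\<lambda>u. real (Suc n) * (u ^ n * exp (w * u)) + w * (u ^ Suc n * exp (w * u))) has_integral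
      (1 ^ Suc n * exp (w * 1) - 0 ^ Suc n * exp (w * 0))) {0..1}"
  proof (rule fundamental_theorem_of_calculus)
    fix u :: real
    have "((\<lambda>u. u ^ Suc n * exp (w * u)) has_real_derivative
        real (Suc n) * (u ^ n * exp (w * u)) + w * (u ^ Suc n * exp (w * u))) (at u within {0..1})"
      using DERIV_pow[of "Suc n" u "{0..1}"]
      by (auto intro!: derivative_eq_intros simp del: power_Suc)
    then show "((\<lambda>u. u ^ Suc n * exp (w * u)) has_vector_derivative
        real (Suc n) * (u ^ n * exp (w * u)) + w * (u ^ Suc n * exp (w * u))) (at u within {0..1})"
      by (simp add: has_real_derivative_iff_has_vector_derivative)
  qed simp
  then have "integral {0..1} (\<lambda>u. real (Suc n) * (u ^ n * exp (w * u)) + w * (u ^ Suc n * exp (w * u))) = exp w"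
    by (simp add: integral_unique)
  then show ?thesis
    unfolding exp_moment_def
    by (subst (asm) integral_add) (auto intro!: integrable_continuous_interval continuous_intros)
qed

lemma exp_moment_nonneg: "0 \<le> exp_moment n w"
  unfolding exp_moment_def
  by (rule integral_nonneg[OF exp_moment_integrable]) auto

lemma exp_moment_le:
  assumes "w \<le> a" "0 \<le> a"
  shows "exp_moment n w \<le> exp a"
proof -
  have "exp_moment n w \<le> integral {0..1} (\<lambda>u::real. exp a)"
    unfolding exp_moment_def
  proof (rule integral_le[OF exp_moment_integrable])
    fix u :: real assume u: "u \<in> {0..1}"
    have "w * u \<le> a * u" using assms u by (intro mult_right_mono) auto
    also have "\<dots> \<le> a" using assms u by (intro mult_left_le) auto
    finally have "u ^ n * exp (w * u) \<le> 1 * exp a"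
      using u by (intro mult_mono power_le_one) auto
    then show "u ^ n * exp (w * u) \<le> exp a" by simp
  qed auto
  then show ?thesis by simp
qed

text \<open>
  Under the exponential law, \<open>max (w - a) 0\<close> has mean \<open>exp (- a)\<close>. Solving the
  first-order equation with the integrating factor \<open>w * exp (- w)\<close> gives
  \<open>g w = - exp (- a) * (exp w - 1) / w\<close> below \<open>a\<close> and \<open>g w = - 1 + (a - 1 + exp (- a)) / w\<close>
  above. Equivalently, on \<open>w \<ge> 0\<close>, \<open>g w\<close> is minus the average over \<open>u \<in> {0..1}\<close> of
  \<open>min 1 (exp (w * u - a))\<close>, which explains why its values lie in \<open>{-1..0}\<close>. The two pieces
  and their first derivatives match at \<open>a\<close>, and \<open>g'\<close> has bounded slope on each side, so it is
  Lipschitz. For \<open>a = 0\<close> the solution degenerates on \<open>w \<ge> 0\<close> to the constant \<open>-1\<close>.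
\<close>

lemma exponential_stein_solution:
  assumes "0 \<le> (a::real)"
  obtains g g' :: "real \<Rightarrow> real" and K
  where "\<And>w. (g has_real_derivative g' w) (at w)"
    and "K-lipschitz_on UNIV g'"
    and "\<And>w. g w \<in> {-1..0}" and "\<And>w. g' w \<in> {-1..0}"
    and "\<And>w. 0 \<le> w \<Longrightarrow> w * g' w + (1 - w) * g w = max (w - a) 0 - exp (- a)"
proof (cases "a = 0")
  case True
  show ?thesis
    by (rule that[of "\<lambda>_. -1" "\<lambda>_. 0" 0]) (auto simp: True lipschitz_on_def)
next
  case False
  then have a: "0 < a" using assms by simp
  define C where "C = a - 1 + exp (- a)"
  \<comment> \<open>The coefficient above \<open>a\<close> in terms of the moment below: this makes \<open>g'\<close> continuous at \<open>a\<close>.\<close>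
  have C: "C = a\<^sup>2 * (exp (- a) * exp_moment 1 a)"
  proof -
    have "a\<^sup>2 * exp_moment 1 a = a * exp a - a * exp_moment 0 a"
      using arg_cong[OF exp_moment_Suc[of a 0], of "(*) a"]
      by (simp add: power2_eq_square algebra_simps)
    also have "\<dots> = a * exp a - exp a + 1" by (simp add: exp_moment_0)
    finally have *: "a\<^sup>2 * exp_moment 1 a = a * exp a - exp a + 1" .
    have "a\<^sup>2 * (exp (- a) * exp_moment 1 a) = exp (- a) * (a\<^sup>2 * exp_moment 1 a)" by simp
    also have "\<dots> = C" unfolding * C_def by (simp add: algebra_simps flip: exp_add)
    finally show ?thesis by simp
  qed
  have C0: "0 \<le> C" unfolding C by (simp add: exp_moment_nonneg)
  have Ca: "C \<le> a" using a by (simp add: C_def)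
  have low: "exp (- a) * exp_moment n w \<in> {0..1}" if "w \<le> a" for n w
  proof -
    have "exp (- a) * exp_moment n w \<le> exp (- a) * exp a"
      using that a by (intro mult_left_mono exp_moment_le) auto
    also have "\<dots> = 1" by (simp flip: exp_add)
    finally show ?thesis by (simp add: exp_moment_nonneg)
  qed
  have C2: "C \<le> a\<^sup>2"
    using mult_left_mono[of "exp (- a) * exp_moment 1 a" "1" "a\<^sup>2"] low[of a 1]
    unfolding C by simp
  define g where "g w = (if w \<in> {..a} then - exp (- a) * exp_moment 0 w else - 1 + C / w)" for w
  define g' where "g' w = (if w \<in> {..a} then - exp (- a) * exp_moment 1 w else - C / w\<^sup>2)" for w
  have glue: "- exp (- a) * exp_moment 0 a = - 1 + C / a"
  proof -
    have "a * (exp (- a) * exp_moment 0 a) = exp (- a) * (exp a - 1)"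
      using exp_moment_0[of a] by simp
    then have "a * (exp (- a) * exp_moment 0 a) = 1 - exp (- a)"
      by (simp add: algebra_simps flip: exp_add)
    then show ?thesis using a by (simp add: C_def field_simps)
  qed
  have glue': "- exp (- a) * exp_moment 1 a = - C / a\<^sup>2"
    using a by (simp add: C)
  \<comment> \<open>Both pieces are differentiable across \<open>a\<close>, so the derivatives can be glued there.\<close>
  have deriv: "(g has_real_derivative g' w) (at w)" for w
  proof -
    have "(g has_vector_derivative g' w) (at w within UNIV)"
      unfolding g_def g'_def
    proof (rule has_vector_derivative_If_within_closures)
      show "UNIV = {..a} \<union> {a<..}" by auto
      show "- exp (- a) * exp_moment 0 x = - 1 + C / x"
        "- exp (- a) * exp_moment 1 x = - C / x\<^sup>2"
        if "x \<in> closure {..a}" "x \<in> closure {a<..}" for x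
      proof -
        have "x = a" using that by auto
        then show "- exp (- a) * exp_moment 0 x = - 1 + C / x"
          "- exp (- a) * exp_moment 1 x = - C / x\<^sup>2" using glue glue' by auto
      qed
      show "((\<lambda>w. - exp (- a) * exp_moment 0 w) has_vector_derivative - exp (- a) * exp_moment 1 w)
          (at w within {..a} \<union> closure {..a} \<inter> closure {a<..})"
        using DERIV_cmult[OF exp_moment_has_real_derivative[of 0 w], of "- exp (- a)"]
        by (simp add: has_real_derivative_iff_has_vector_derivative has_vector_derivative_at_within)
      show "((\<lambda>w. - 1 + C / w) has_vector_derivative - C / w\<^sup>2)
          (at w within {a<..} \<union> closure {..a} \<inter> closure {a<..})"
        if "w \<in> {a<..} \<union> closure {..a} \<inter> closure {a<..}"
      proof -
        have "w > 0" using that a by auto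
        then have "((\<lambda>w. - 1 + C / w) has_real_derivative - C / w\<^sup>2) (at w)"
          by (auto intro!: derivative_eq_intros simp: power2_eq_square)
        then show ?thesis
          by (simp add: has_real_derivative_iff_has_vector_derivative has_vector_derivative_at_within)
      qed
    qed auto
    then show ?thesis by (simp add: has_real_derivative_iff_has_vector_derivative)
  qed
  have lip_left: "\<bar>g' x - g' y\<bar> \<le> \<bar>x - y\<bar>" if "x \<le> a" "y \<le> a" for x y
  proof -
    have "norm (- exp (- a) * exp_moment 1 x - - exp (- a) * exp_moment 1 y) \<le> 1 * norm (x - y)"
    proof (rule field_differentiable_bound[where S = "{..a}"])
      show "((\<lambda>w. - exp (- a) * exp_moment 1 w) has_real_derivative - exp (- a) * exp_moment 2 w)
          (at w within {..a})" for w
        using DERIV_cmult[OF exp_moment_has_real_derivative[of 1 w], of "- exp (- a)"]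
        by (simp add: numeral_2_eq_2 has_field_derivative_at_within)
      show "norm (- exp (- a) * exp_moment 2 w) \<le> 1" if "w \<in> {..a}" for w
        using low[of w 2] that by simp
    qed (use that in auto)
    then show ?thesis using that by (simp add: g'_def)
  qed
  have g'_right: "g' w = - C / w\<^sup>2" if "a \<le> w" for w
    using that glue' by (cases "w = a") (auto simp: g'_def)
  have lip_right: "\<bar>g' x - g' y\<bar> \<le> 2 * C / a ^ 3 * \<bar>x - y\<bar>" if "a \<le> x" "a \<le> y" for x y
  proof -
    have "norm (- C / x\<^sup>2 - - C / y\<^sup>2) \<le> 2 * C / a ^ 3 * norm (x - y)"
    proof (rule field_differentiable_bound[where S = "{a..}"])
      show "((\<lambda>w. - C / w\<^sup>2) has_real_derivative 2 * C / w ^ 3) (at w within {a..})"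
        if "w \<in> {a..}" for w
        using that a by (auto intro!: derivative_eq_intros simp: field_simps eval_nat_numeral)
      show "norm (2 * C / w ^ 3) \<le> 2 * C / a ^ 3" if "w \<in> {a..}" for w
        using that a C0 by (auto intro!: divide_left_mono power_mono mult_pos_pos)
    qed (use that in auto)
    then show ?thesis using that by (simp add: g'_right)
  qed
  define K where "K = 1 + 2 * C / a ^ 3"
  have K: "1 \<le> K" "2 * C / a ^ 3 \<le> K" using C0 a by (auto simp: K_def)
  have lip: "\<bar>g' x - g' y\<bar> \<le> K * \<bar>x - y\<bar>" if "x \<le> y" for x y
  proof -
    have L: "\<bar>g' x - g' y\<bar> \<le> K * \<bar>x - y\<bar>" if "x \<le> a" "y \<le> a" for x y
      using order_trans[OF lip_left[OF that], of "K * \<bar>x - y\<bar>"]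
        mult_right_mono[OF K(1) abs_ge_zero[of "x - y"]] by simp
    have R: "\<bar>g' x - g' y\<bar> \<le> K * \<bar>x - y\<bar>" if "a \<le> x" "a \<le> y" for x y
      using lip_right[OF that] mult_right_mono[OF K(2) abs_ge_zero[of "x - y"]] by (rule order_trans)
    consider "y \<le> a" | "a \<le> x" | "x \<le> a" "a \<le> y" by linarith
    then show ?thesis
    proof cases
      case 3
      have "\<bar>g' x - g' y\<bar> \<le> K * \<bar>x - a\<bar> + K * \<bar>a - y\<bar>"
        using L[of x a] R[of a y] 3 by linarith
      also have "\<dots> = K * \<bar>x - y\<bar>" using 3 by (simp add: algebra_simps)
      finally show ?thesis .
    qed (use L[of x y] R[of x y] that in auto)
  qed
  show ?thesis
  proof (rule that[of g g' K])
    show "(g has_real_derivative g' w) (at w)" for w by (rule deriv)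
    show "K-lipschitz_on UNIV g'"
    proof (rule lipschitz_onI)
      show "dist (g' x) (g' y) \<le> K * dist x y" for x y
        unfolding dist_real_def
        using lip[of x y] lip[of y x] abs_minus_commute[of x y] abs_minus_commute[of "g' x" "g' y"]
        by (metis linear)
    qed (use K in auto)
    show "g w \<in> {-1..0}" for w
    proof (cases "w \<le> a")
      case True
      then show ?thesis using low[of w 0] by (simp add: g_def)
    next
      case False
      then have "C / w \<in> {0..1}" using a C0 Ca by auto
      then show ?thesis using False by (simp add: g_def)
    qed
    show "g' w \<in> {-1..0}" for w
    proof (cases "w \<le> a")
      case True
      then show ?thesis using low[of w 1] by (simp add: g'_def)
    next
      case False
      then have "C \<le> w\<^sup>2"
        using a by (intro order_trans[OF C2] power_mono) auto
      then have "C / w\<^sup>2 \<in> {0..1}" using a C0 False by (auto simp: field_simps)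
      then show ?thesis using False by (simp add: g'_def)
    qed
    show "w * g' w + (1 - w) * g w = max (w - a) 0 - exp (- a)" for w
    proof (cases "w \<le> a")
      case True
      have "w * g' w + (1 - w) * g w =
          - exp (- a) * (w * exp_moment 1 w + exp_moment 0 w - w * exp_moment 0 w)"
        using True by (simp add: g_def g'_def algebra_simps)
      also have "\<dots> = - exp (- a)"
        using exp_moment_Suc[of w 0] exp_moment_0[of w] by simp
      finally show ?thesis using True by simp
    next
      case False
      then have "w * g' w + (1 - w) * g w = w - 1 - C"
        using a by (simp add: g_def g'_def field_simps power2_eq_square)
      then show ?thesis using False by (simp add: C_def)
    qed
  qed
qed

section \<open>Exchangeable pairs and conditional expectations\<close>

lemma integral_abs_le_integral:
  fixes f g :: "'a \<Rightarrow> real"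
  assumes "integrable M f" "integrable M g" "\<And>x. \<bar>f x\<bar> \<le> g x"
  shows "\<bar>integral\<^sup>L M f\<bar> \<le> integral\<^sup>L M g"
  by (rule order_trans[OF integral_abs_bound integral_mono[OF integrable_abs[OF assms(1)] assms(2,3)]])

lemma borel_measurable_DERIV:
  fixes g g' :: "real \<Rightarrow> real"
  assumes "\<And>w. (g has_real_derivative g' w) (at w)"
  shows "g \<in> borel_measurable borel"
  using assms by (intro borel_measurable_continuous_onI continuous_at_imp_continuous_on ballI) (rule DERIV_isCont)

lemma borel_measurable_lipschitz:
  fixes g :: "real \<Rightarrow> real"
  assumes "K-lipschitz_on UNIV g"
  shows "g \<in> borel_measurable borel"
  by (rule borel_measurable_continuous_onI[OF lipschitz_on_continuous_on[OF assms]])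

lemma bounded_mult_integrable:
  fixes f X :: "'a \<Rightarrow> real"
  assumes "f \<in> borel_measurable M" "\<And>\<omega>. \<bar>f \<omega>\<bar> \<le> 1" and X: "integrable M X"
  shows "integrable M (\<lambda>\<omega>. f \<omega> * X \<omega>)"
proof (rule Bochner_Integration.integrable_bound[OF X])
  show "AE \<omega> in M. norm (f \<omega> * X \<omega>) \<le> norm (X \<omega>)"
    using assms(2) by (auto simp: abs_mult intro!: mult_left_le_one_le)
qed (intro borel_measurable_times assms(1) borel_measurable_integrable[OF X])

text \<open>
  A bounded \<open>F\<close>-measurable weight \<open>f\<close> turns an almost sure approximation of the conditional
  expectation of \<open>X\<close> into an approximation of the number \<open>LINT \<omega>|M. f \<omega> * X \<omega>\<close> with the same
  error, since \<open>X\<close> may be replaced by its conditional expectation under that integral.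
\<close>

lemma (in prob_space) real_cond_exp_test_bound:
  fixes X f A :: "'a \<Rightarrow> real"
  assumes sub: "subalgebra M F"
    and X: "integrable M X" and A: "integrable M A"
    and f: "f \<in> borel_measurable F" "\<And>\<omega>. \<bar>f \<omega>\<bar> \<le> 1"
    and AE: "AE \<omega> in M. \<bar>real_cond_exp M F X \<omega> - t * A \<omega>\<bar> \<le> r"
  shows "\<bar>(LINT \<omega>|M. f \<omega> * X \<omega>) - t * (LINT \<omega>|M. f \<omega> * A \<omega>)\<bar> \<le> r"
proof -
  interpret finite_measure_subalgebra M F by unfold_locales (rule sub)
  have fM [measurable]: "f \<in> borel_measurable M"
    using measurable_from_subalg[OF sub f(1)] .
  note int = bounded_mult_integrable[OF fM f(2)]
  note ce = real_cond_exp_int(1)[OF X]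
  have "(LINT \<omega>|M. f \<omega> * X \<omega>) = (LINT \<omega>|M. f \<omega> * real_cond_exp M F X \<omega>)"
    by (rule real_cond_exp_intg(2)[OF int[OF X] f(1) borel_measurable_integrable[OF X], symmetric])
  moreover have *: "f \<omega> * (real_cond_exp M F X \<omega> - t * A \<omega>) =
      f \<omega> * real_cond_exp M F X \<omega> - t * (f \<omega> * A \<omega>)" for \<omega>
    by (simp add: algebra_simps)
  ultimately have "(LINT \<omega>|M. f \<omega> * X \<omega>) - t * (LINT \<omega>|M. f \<omega> * A \<omega>) =
      (LINT \<omega>|M. f \<omega> * (real_cond_exp M F X \<omega> - t * A \<omega>))"
    using int[OF ce] int[OF A] by (simp add: * )
  moreover have "\<bar>LINT \<omega>|M. f \<omega> * (real_cond_exp M F X \<omega> - t * A \<omega>)\<bar> \<le>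
      (LINT \<omega>|M. \<bar>f \<omega> * (real_cond_exp M F X \<omega> - t * A \<omega>)\<bar>)"
    by (rule integral_abs_bound)
  moreover have "\<dots> \<le> r"
  proof (rule integral_le_const)
    show "integrable M (\<lambda>\<omega>. \<bar>f \<omega> * (real_cond_exp M F X \<omega> - t * A \<omega>)\<bar>)"
      by (intro integrable_abs int Bochner_Integration.integrable_diff ce integrable_mult_right A)
    show "AE \<omega> in M. \<bar>f \<omega> * (real_cond_exp M F X \<omega> - t * A \<omega>)\<bar> \<le> r"
      using AE
    proof eventually_elim
      case (elim \<omega>)
      have "\<bar>f \<omega> * (real_cond_exp M F X \<omega> - t * A \<omega>)\<bar> \<le> 1 * \<bar>real_cond_exp M F X \<omega> - t * A \<omega>\<bar>"
        unfolding abs_mult by (intro mult_right_mono f) auto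
      with elim show ?case by simp
    qed
  qed
  ultimately show ?thesis by linarith
qed

text \<open>
  One small \<open>t\<close> suffices: then \<open>t * A\<close> differs from an integrable conditional expectation by a
  bounded function. This supplies the integrability of the error terms \<open>E\<close> and \<open>E'\<close>.
\<close>

lemma (in prob_space) random_bigo_sq_imp_integrable:
  fixes X :: "real \<Rightarrow> 'a \<Rightarrow> real" and A :: "'a \<Rightarrow> real"
  assumes sub: "subalgebra M F"
    and X: "\<And>t. 0 < t \<Longrightarrow> integrable M (X t)"
    and A [measurable]: "A \<in> borel_measurable M"
    and O: "random_bigo_sq M (\<lambda>t \<omega>. real_cond_exp M F (X t) \<omega> - t * A \<omega>)"
  shows "integrable M A"
proof -
  interpret finite_measure_subalgebra M F by unfold_locales (rule sub)
  obtain C where "\<forall>\<^sub>F t in at_right 0. AE \<omega> in M. \<bar>real_cond_exp M F (X t) \<omega> - t * A \<omega>\<bar> \<le> C * t\<^sup>2"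
    using O unfolding random_bigo_sq_def by blast
  then have "\<forall>\<^sub>F t in at_right 0. 0 < t \<and> (AE \<omega> in M. \<bar>real_cond_exp M F (X t) \<omega> - t * A \<omega>\<bar> \<le> C * t\<^sup>2)"
    by (intro eventually_conj eventually_at_right_less)
  then obtain t where t: "0 < t" and AE: "AE \<omega> in M. \<bar>real_cond_exp M F (X t) \<omega> - t * A \<omega>\<bar> \<le> C * t\<^sup>2"
    using eventually_happens'[OF trivial_limit_at_right_real] by blast
  note ce = real_cond_exp_int(1)[OF X[OF t]]
  have "integrable M (\<lambda>\<omega>. real_cond_exp M F (X t) \<omega> - t * A \<omega>)"
    using AE by (intro integrable_const_bound[where B = "C * t\<^sup>2"]) auto
  from Bochner_Integration.integrable_diff[OF ce this] have "integrable M (\<lambda>\<omega>. t * A \<omega>)" by simp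
  then show ?thesis using t by simp
qed

lemma exchangeable_pair_integral:
  fixes s :: "real \<Rightarrow> real \<Rightarrow> real"
  assumes ex: "exchangeable_pair M X X'"
    and s [measurable]: "(\<lambda>(x, y). s x y) \<in> borel_measurable (borel \<Otimes>\<^sub>M borel)"
  shows "(LINT \<omega>|M. s (X \<omega>) (X' \<omega>)) = (LINT \<omega>|M. s (X' \<omega>) (X \<omega>))"
    and "integrable M (\<lambda>\<omega>. s (X \<omega>) (X' \<omega>)) \<longleftrightarrow> integrable M (\<lambda>\<omega>. s (X' \<omega>) (X \<omega>))"
proof -
  have [measurable]: "X \<in> borel_measurable M" "X' \<in> borel_measurable M"
    and eq: "distr M (borel \<Otimes>\<^sub>M borel) (\<lambda>\<omega>. (X \<omega>, X' \<omega>)) =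
     distr M (borel \<Otimes>\<^sub>M borel) (\<lambda>\<omega>. (X' \<omega>, X \<omega>))"
    using ex by (auto simp: exchangeable_pair_def)
  show "(LINT \<omega>|M. s (X \<omega>) (X' \<omega>)) = (LINT \<omega>|M. s (X' \<omega>) (X \<omega>))"
    using arg_cong[OF eq, of "\<lambda>D. integral\<^sup>L D (\<lambda>(x, y). s x y)"] by (simp add: integral_distr)
  show "integrable M (\<lambda>\<omega>. s (X \<omega>) (X' \<omega>)) \<longleftrightarrow> integrable M (\<lambda>\<omega>. s (X' \<omega>) (X \<omega>))"
    using arg_cong[OF eq, of "\<lambda>D. integrable D (\<lambda>(x, y). s x y)"] by (simp add: integrable_distr_eq)
qed

text \<open>
  The left-hand side is \<open>(y - x)\<^sup>2 * \<bar>g' \<xi> - g' x\<bar>\<close> for an intermediate point \<open>\<xi>\<close>. For increments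
  of size at most \<open>\<eta>\<close> the Lipschitz bound on \<open>g'\<close> applies; for larger ones only the boundedness
  of \<open>g'\<close> is available, and the resulting term is the one that the absence of macroscopic jumps
  controls.
\<close>

lemma antisymmetric_increment_expansion:
  fixes g g' :: "real \<Rightarrow> real"
  assumes deriv: "\<And>w. (g has_real_derivative g' w) (at w)"
    and lip: "K-lipschitz_on UNIV g'"
    and g': "\<And>w. g' w \<in> {-1..0}"
    and \<eta>: "0 < \<eta>"
  shows "\<bar>(y - x) * (g x + g y) - (2 * (g x * (y - x)) + g' x * (y - x)\<^sup>2)\<bar> \<le>
    K * \<eta> * (y - x)\<^sup>2 + indicator {d. \<bar>d\<bar>\<^sup>2 > \<eta>\<^sup>2} (y - x) * (y - x)\<^sup>2"
proof -
  have "\<exists>\<xi>. g y - g x = (y - x) * g' \<xi> \<and> \<bar>\<xi> - x\<bar> \<le> \<bar>y - x\<bar>"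
  proof (cases x y rule: linorder_cases)
    case less
    from MVT2[OF this deriv] show ?thesis by force
  next
    case equal
    then show ?thesis by auto
  next
    case greater
    from MVT2[OF this deriv] obtain z where "y < z" "z < x" "g x - g y = (x - y) * g' z" by blast
    then show ?thesis by (intro exI[of _ z]) (auto simp: algebra_simps)
  qed
  then obtain \<xi> where \<xi>: "g y - g x = (y - x) * g' \<xi>" "\<bar>\<xi> - x\<bar> \<le> \<bar>y - x\<bar>" by blast
  have K: "0 \<le> K" using lip by (rule lipschitz_on_nonneg)
  have "(y - x) * (g x + g y) - (2 * (g x * (y - x)) + g' x * (y - x)\<^sup>2)
      = (y - x) * (g y - g x) - g' x * (y - x)\<^sup>2"
    by (simp add: algebra_simps)
  also have "\<dots> = (y - x)\<^sup>2 * (g' \<xi> - g' x)"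
    unfolding \<xi> by (simp add: power2_eq_square algebra_simps)
  finally have eq: "\<bar>(y - x) * (g x + g y) - (2 * (g x * (y - x)) + g' x * (y - x)\<^sup>2)\<bar>
      = (y - x)\<^sup>2 * \<bar>g' \<xi> - g' x\<bar>" by (simp add: abs_mult)
  show ?thesis
  proof (cases "\<bar>y - x\<bar>\<^sup>2 > \<eta>\<^sup>2")
    case True
    have "(y - x)\<^sup>2 * \<bar>g' \<xi> - g' x\<bar> \<le> (y - x)\<^sup>2 * 1"
      using g'[of \<xi>] g'[of x] by (intro mult_left_mono) auto
    moreover have "0 \<le> K * \<eta> * (y - x)\<^sup>2" using K \<eta> by simp
    ultimately show ?thesis using True unfolding eq by simp
  next
    case False
    then have "\<bar>y - x\<bar> \<le> \<eta>" using \<eta> by (intro power2_le_imp_le[of "\<bar>y - x\<bar>"]) auto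
    then have "\<bar>\<xi> - x\<bar> \<le> \<eta>" using \<xi> by simp
    then have "\<bar>g' \<xi> - g' x\<bar> \<le> K * \<eta>"
      using lipschitz_onD[OF lip, of \<xi> x] mult_left_mono[OF _ K, of "\<bar>\<xi> - x\<bar>" \<eta>]
      by (simp add: dist_real_def)
    then have "(y - x)\<^sup>2 * \<bar>g' \<xi> - g' x\<bar> \<le> (y - x)\<^sup>2 * (K * \<eta>)"
      by (intro mult_left_mono) auto
    then show ?thesis using False unfolding eq by (simp add: mult.commute)
  qed
qed

section \<open>The Stein identity for a family of exchangeable pairs\<close>

locale exponential_exchangeable_family = prob_space M
  for M :: "'a measure" +
  fixes F :: "'a measure" and W :: "'a \<Rightarrow> real" and Wt :: "real \<Rightarrow> 'a \<Rightarrow> real"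
    and E E' :: "'a \<Rightarrow> real" and \<Lambda> :: real
  assumes W_nonneg: "AE \<omega> in M. 0 \<le> W \<omega>"
    and W_square_integrable: "integrable M (\<lambda>\<omega>. (W \<omega>)\<^sup>2)"
    and exch: "\<And>t. 0 < t \<Longrightarrow> exchangeable_pair M W (Wt t)"
    and subalg: "subalgebra M F"
    and W_F [measurable]: "W \<in> borel_measurable F"
    and E_F [measurable]: "E \<in> borel_measurable F"
    and E'_F [measurable]: "E' \<in> borel_measurable F"
    and drift: "random_bigo_sq M (\<lambda>t \<omega>. real_cond_exp M F (\<lambda>\<omega>. Wt t \<omega> - W \<omega>) \<omega>
           - t * (\<Lambda> * (1 - W \<omega>) + E \<omega>))"
    and diffusion: "random_bigo_sq M (\<lambda>t \<omega>. real_cond_exp M F (\<lambda>\<omega>. (Wt t \<omega> - W \<omega>)\<^sup>2) \<omega>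
           - t * (2 * \<Lambda> * W \<omega> + E' \<omega>))"
    and no_jumps: "\<And>\<rho>. 0 < \<rho> \<Longrightarrow>
           ((\<lambda>t. 1 / t * (LINT \<omega>|M. \<bar>Wt t \<omega> - W \<omega>\<bar>\<^sup>2 *
                indicator {\<omega>. \<bar>Wt t \<omega> - W \<omega>\<bar>\<^sup>2 > \<rho>} \<omega>)) \<longlongrightarrow> 0) (at_right 0)"
begin

lemma measurable_M [measurable]:
  "W \<in> borel_measurable M" "E \<in> borel_measurable M" "E' \<in> borel_measurable M"
  using measurable_from_subalg[OF subalg W_F] measurable_from_subalg[OF subalg E_F]
    measurable_from_subalg[OF subalg E'_F] by blast+

lemma Wt_measurable: "0 < t \<Longrightarrow> Wt t \<in> borel_measurable M"
  using exch by (simp add: exchangeable_pair_def)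

lemma W_integrable: "integrable M W"
  by (rule square_integrable_imp_integrable[OF _ W_square_integrable]) simp

lemma increment_integrable:
  assumes t: "0 < t"
  shows "integrable M (\<lambda>\<omega>. (Wt t \<omega> - W \<omega>)\<^sup>2)" and "integrable M (\<lambda>\<omega>. Wt t \<omega> - W \<omega>)"
proof -
  have D_meas: "(\<lambda>\<omega>. Wt t \<omega> - W \<omega>) \<in> borel_measurable M"
    by (intro borel_measurable_diff Wt_measurable[OF t] measurable_M)
  have Wt2: "integrable M (\<lambda>\<omega>. (Wt t \<omega>)\<^sup>2)"
    using exchangeable_pair_integral(2)[OF exch[OF t], of "\<lambda>x y. y\<^sup>2"] W_square_integrable
    by (simp add: case_prod_beta)
  show sq: "integrable M (\<lambda>\<omega>. (Wt t \<omega> - W \<omega>)\<^sup>2)"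
  proof (rule Bochner_Integration.integrable_bound)
    show "integrable M (\<lambda>\<omega>. 2 * (Wt t \<omega>)\<^sup>2 + 2 * (W \<omega>)\<^sup>2)"
      using Wt2 W_square_integrable by simp
    show "AE \<omega> in M. norm ((Wt t \<omega> - W \<omega>)\<^sup>2) \<le> norm (2 * (Wt t \<omega>)\<^sup>2 + 2 * (W \<omega>)\<^sup>2)"
    proof (rule AE_I2)
      fix \<omega>
      have "(Wt t \<omega> - W \<omega>)\<^sup>2 + (Wt t \<omega> + W \<omega>)\<^sup>2 = 2 * (Wt t \<omega>)\<^sup>2 + 2 * (W \<omega>)\<^sup>2"
        by (simp add: power2_sum power2_diff)
      then have "(Wt t \<omega> - W \<omega>)\<^sup>2 \<le> 2 * (Wt t \<omega>)\<^sup>2 + 2 * (W \<omega>)\<^sup>2"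
        using zero_le_power2[of "Wt t \<omega> + W \<omega>"] by linarith
      then show "norm ((Wt t \<omega> - W \<omega>)\<^sup>2) \<le> norm (2 * (Wt t \<omega>)\<^sup>2 + 2 * (W \<omega>)\<^sup>2)"
        by simp
    qed
  qed (rule borel_measurable_power[OF D_meas])
  show "integrable M (\<lambda>\<omega>. Wt t \<omega> - W \<omega>)"
    by (rule square_integrable_imp_integrable[OF D_meas sq])
qed

lemma drift_integrable: "integrable M (\<lambda>\<omega>. \<Lambda> * (1 - W \<omega>) + E \<omega>)"
  by (rule random_bigo_sq_imp_integrable[OF subalg increment_integrable(2) _ drift]) measurable

lemma diffusion_integrable: "integrable M (\<lambda>\<omega>. 2 * \<Lambda> * W \<omega> + E' \<omega>)"
  by (rule random_bigo_sq_imp_integrable[OF subalg increment_integrable(1) _ diffusion]) measurable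

lemma error_integrable: "integrable M E" "integrable M E'"
proof -
  have "integrable M (\<lambda>\<omega>. (\<Lambda> * (1 - W \<omega>) + E \<omega>) - \<Lambda> * (1 - W \<omega>))"
    using W_integrable by (intro Bochner_Integration.integrable_diff drift_integrable) auto
  then show "integrable M E" by simp
  have "integrable M (\<lambda>\<omega>. (2 * \<Lambda> * W \<omega> + E' \<omega>) - 2 * \<Lambda> * W \<omega>)"
    using W_integrable by (intro Bochner_Integration.integrable_diff diffusion_integrable) auto
  then show "integrable M E'" by simp
qed

text \<open>
  The function \<open>(x, y) \<mapsto> (y - x) * (g x + g y)\<close> is antisymmetric, so its expectation at
  \<open>(W, Wt t)\<close> vanishes by exchangeability. Its expansion at \<open>x\<close> has the terms
  \<open>2 * g x * (y - x)\<close> and \<open>g' x * (y - x)\<^sup>2\<close>, whose expectations are, to first order in \<open>t\<close>,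
  given by the drift and the diffusion coefficient. After division by \<open>t\<close> and the limit
  \<open>t \<rightarrow> 0\<close>, what remains of the expansion error is a multiple of the cut-off \<open>\<eta>\<close>, which is
  arbitrary.
\<close>

lemma generator_identity:
  fixes g g' :: "real \<Rightarrow> real"
  assumes deriv: "\<And>w. (g has_real_derivative g' w) (at w)"
    and lip: "K-lipschitz_on UNIV g'"
    and g: "\<And>w. g w \<in> {-1..0}" and g': "\<And>w. g' w \<in> {-1..0}"
  shows "2 * (LINT \<omega>|M. g (W \<omega>) * (\<Lambda> * (1 - W \<omega>) + E \<omega>))
       + (LINT \<omega>|M. g' (W \<omega>) * (2 * \<Lambda> * W \<omega> + E' \<omega>)) = 0"
    (is "?I = 0")
proof -
  note [measurable] = borel_measurable_DERIV[OF deriv] borel_measurable_lipschitz[OF lip]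
  have gb: "\<bar>g w\<bar> \<le> 1" "\<bar>g' w\<bar> \<le> 1" for w using g[of w] g'[of w] by auto
  have K: "0 \<le> K" using lip by (rule lipschitz_on_nonneg)
  obtain C1 where C1: "\<forall>\<^sub>F t in at_right 0. AE \<omega> in M.
      \<bar>real_cond_exp M F (\<lambda>\<omega>. Wt t \<omega> - W \<omega>) \<omega> - t * (\<Lambda> * (1 - W \<omega>) + E \<omega>)\<bar> \<le> C1 * t\<^sup>2"
    using drift unfolding random_bigo_sq_def by blast
  obtain C2 where C2: "\<forall>\<^sub>F t in at_right 0. AE \<omega> in M.
      \<bar>real_cond_exp M F (\<lambda>\<omega>. (Wt t \<omega> - W \<omega>)\<^sup>2) \<omega> - t * (2 * \<Lambda> * W \<omega> + E' \<omega>)\<bar> \<le> C2 * t\<^sup>2"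
    using diffusion unfolding random_bigo_sq_def by blast
  define B where "B = (LINT \<omega>|M. 2 * \<Lambda> * W \<omega> + E' \<omega>)"
  define J where "J \<rho> t = 1 / t * (LINT \<omega>|M. \<bar>Wt t \<omega> - W \<omega>\<bar>\<^sup>2 *
                indicator {\<omega>. \<bar>Wt t \<omega> - W \<omega>\<bar>\<^sup>2 > \<rho>} \<omega>)" for \<rho> t
  have step: "\<bar>?I\<bar> \<le> K * \<eta> * (B + C2 * t) + J (\<eta>\<^sup>2) t + (2 * C1 + C2) * t"
    if t: "0 < t" and \<eta>: "0 < \<eta>"
      and AE1: "AE \<omega> in M. \<bar>real_cond_exp M F (\<lambda>\<omega>. Wt t \<omega> - W \<omega>) \<omega> - t * (\<Lambda> * (1 - W \<omega>) + E \<omega>)\<bar> \<le> C1 * t\<^sup>2"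
      and AE2: "AE \<omega> in M. \<bar>real_cond_exp M F (\<lambda>\<omega>. (Wt t \<omega> - W \<omega>)\<^sup>2) \<omega> - t * (2 * \<Lambda> * W \<omega> + E' \<omega>)\<bar> \<le> C2 * t\<^sup>2"
    for t \<eta>
  proof -
    note [measurable] = Wt_measurable[OF t]
    define D where "D \<omega> = Wt t \<omega> - W \<omega>" for \<omega>
    have [measurable]: "D \<in> borel_measurable M" unfolding D_def by simp
    have D: "integrable M D" "integrable M (\<lambda>\<omega>. (D \<omega>)\<^sup>2)"
      using increment_integrable[OF t] by (simp_all add: D_def[abs_def])
    have gF: "(\<lambda>\<omega>. g (W \<omega>)) \<in> borel_measurable F" "(\<lambda>\<omega>. g' (W \<omega>)) \<in> borel_measurable F" by auto
    have d1: "\<bar>(LINT \<omega>|M. g (W \<omega>) * D \<omega>) - t * (LINT \<omega>|M. g (W \<omega>) * (\<Lambda> * (1 - W \<omega>) + E \<omega>))\<bar> \<le> C1 * t\<^sup>2"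
      using AE1 by (intro real_cond_exp_test_bound[OF subalg D(1) drift_integrable gF(1) gb(1)]) (simp add: D_def[abs_def])
    have d2: "\<bar>(LINT \<omega>|M. g' (W \<omega>) * (D \<omega>)\<^sup>2) - t * (LINT \<omega>|M. g' (W \<omega>) * (2 * \<Lambda> * W \<omega> + E' \<omega>))\<bar> \<le> C2 * t\<^sup>2"
      using AE2 by (intro real_cond_exp_test_bound[OF subalg D(2) diffusion_integrable gF(2) gb(2)]) (simp add: D_def[abs_def])
    \<comment> \<open>The constant weight bounds the second moment of the increment by a multiple of \<open>t\<close>.\<close>
    have d3: "\<bar>(LINT \<omega>|M. (D \<omega>)\<^sup>2) - t * B\<bar> \<le> C2 * t\<^sup>2"
      using AE2 real_cond_exp_test_bound[OF subalg D(2) diffusion_integrable, of "\<lambda>_. 1" t "C2 * t\<^sup>2"]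
      by (simp add: D_def[abs_def] B_def)
    note int = bounded_mult_integrable[OF _ gb(1) D(1)] bounded_mult_integrable[OF _ gb(2) D(2)]
      bounded_mult_integrable[OF _ gb(1) D(1), of "Wt t"]
    define s where "s x y = (y - x) * (g x + g y)" for x y
    have s [measurable]: "(\<lambda>(x, y). s x y) \<in> borel_measurable (borel \<Otimes>\<^sub>M borel)"
      unfolding s_def by measurable
    have "s (W \<omega>) (Wt t \<omega>) = g (W \<omega>) * D \<omega> + g (Wt t \<omega>) * D \<omega>" for \<omega>
      by (simp add: s_def D_def algebra_simps)
    then have s_int: "integrable M (\<lambda>\<omega>. s (W \<omega>) (Wt t \<omega>))"
      using int(1)[of W] int(3) by simp
    have "(LINT \<omega>|M. s (W \<omega>) (Wt t \<omega>)) = (LINT \<omega>|M. s (Wt t \<omega>) (W \<omega>))"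
      by (rule exchangeable_pair_integral(1)[OF exch[OF t] s])
    also have "\<dots> = (LINT \<omega>|M. - s (W \<omega>) (Wt t \<omega>))"
      by (rule Bochner_Integration.integral_cong) (auto simp: s_def algebra_simps)
    finally have s0: "(LINT \<omega>|M. s (W \<omega>) (Wt t \<omega>)) = 0" by simp
    define q where "q \<omega> = 2 * (g (W \<omega>) * D \<omega>) + g' (W \<omega>) * (D \<omega>)\<^sup>2" for \<omega>
    have q_int: "integrable M q"
      unfolding q_def using int(1)[of W] int(2)[of W] by simp
    have q_eq: "integral\<^sup>L M q = 2 * (LINT \<omega>|M. g (W \<omega>) * D \<omega>) + (LINT \<omega>|M. g' (W \<omega>) * (D \<omega>)\<^sup>2)"
      unfolding q_def using int(1)[of W] int(2)[of W] by simp
    define j where "j \<omega> = \<bar>D \<omega>\<bar>\<^sup>2 * indicator {\<omega>. \<bar>D \<omega>\<bar>\<^sup>2 > \<eta>\<^sup>2} \<omega>" for \<omega>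
    have j_eq: "j \<omega> = indicator {d. \<bar>d\<bar>\<^sup>2 > \<eta>\<^sup>2} (D \<omega>) * (D \<omega>)\<^sup>2" for \<omega>
      by (simp add: j_def indicator_def)
    have j_int: "integrable M j"
      unfolding j_eq[abs_def] by (rule bounded_mult_integrable[OF _ _ D(2)]) (auto simp: indicator_def)
    have "\<bar>LINT \<omega>|M. s (W \<omega>) (Wt t \<omega>) - q \<omega>\<bar> \<le> (LINT \<omega>|M. K * \<eta> * (D \<omega>)\<^sup>2 + j \<omega>)"
    proof (rule integral_abs_le_integral)
      show "\<bar>s (W \<omega>) (Wt t \<omega>) - q \<omega>\<bar> \<le> K * \<eta> * (D \<omega>)\<^sup>2 + j \<omega>" for \<omega>
        using antisymmetric_increment_expansion[OF deriv lip g' \<eta>, of "Wt t \<omega>" "W \<omega>"]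
        by (simp add: s_def q_def j_eq D_def)
    qed (use s_int q_int D j_int in auto)
    then have "\<bar>integral\<^sup>L M q\<bar> \<le> K * \<eta> * (LINT \<omega>|M. (D \<omega>)\<^sup>2) + integral\<^sup>L M j"
      using s_int q_int D j_int s0 by simp
    moreover have "K * \<eta> * (LINT \<omega>|M. (D \<omega>)\<^sup>2) \<le> K * \<eta> * (t * B + C2 * t\<^sup>2)"
      using d3 K \<eta> by (intro mult_left_mono) auto
    moreover have "integral\<^sup>L M j = t * J (\<eta>\<^sup>2) t"
      using t by (simp add: J_def j_def[abs_def] D_def)
    moreover have "\<bar>integral\<^sup>L M q - t * ?I\<bar> \<le> (2 * C1 + C2) * t\<^sup>2"
    proof -
      have "integral\<^sup>L M q - t * ?I =
        2 * ((LINT \<omega>|M. g (W \<omega>) * D \<omega>) - t * (LINT \<omega>|M. g (W \<omega>) * (\<Lambda> * (1 - W \<omega>) + E \<omega>)))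
        + ((LINT \<omega>|M. g' (W \<omega>) * (D \<omega>)\<^sup>2) - t * (LINT \<omega>|M. g' (W \<omega>) * (2 * \<Lambda> * W \<omega> + E' \<omega>)))"
        unfolding q_eq by (simp add: algebra_simps)
      then show ?thesis using d1 d2 by (simp add: distrib_right)
    qed
    ultimately have "\<bar>t * ?I\<bar> \<le> K * \<eta> * (t * B + C2 * t\<^sup>2) + t * J (\<eta>\<^sup>2) t + (2 * C1 + C2) * t\<^sup>2"
      by linarith
    also have "\<dots> = t * (K * \<eta> * (B + C2 * t) + J (\<eta>\<^sup>2) t + (2 * C1 + C2) * t)"
      by (simp add: algebra_simps power2_eq_square)
    finally show ?thesis using t by (simp add: abs_mult)
  qed
  \<comment> \<open>The cut-off is fixed while \<open>t\<close> tends to \<open>0\<close>; it tends to \<open>0\<close> afterwards.\<close>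
  have lim: "\<bar>?I\<bar> \<le> K * \<eta> * B" if \<eta>: "0 < \<eta>" for \<eta>
  proof (rule tendsto_lowerbound)
    have "((\<lambda>t. K * \<eta> * (B + C2 * t) + J (\<eta>\<^sup>2) t + (2 * C1 + C2) * t) \<longlongrightarrow>
        K * \<eta> * (B + C2 * 0) + 0 + (2 * C1 + C2) * 0) (at_right 0)"
      using no_jumps[of "\<eta>\<^sup>2"] \<eta> unfolding J_def by (intro tendsto_intros) auto
    then show "((\<lambda>t. K * \<eta> * (B + C2 * t) + J (\<eta>\<^sup>2) t + (2 * C1 + C2) * t) \<longlongrightarrow> K * \<eta> * B) (at_right 0)"
      by simp
    show "\<forall>\<^sub>F t in at_right 0. \<bar>?I\<bar> \<le> K * \<eta> * (B + C2 * t) + J (\<eta>\<^sup>2) t + (2 * C1 + C2) * t"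
      using C1 C2 eventually_at_right_less[of "0::real"]
      by eventually_elim (rule step[OF _ \<eta>])
  qed simp
  have "\<bar>?I\<bar> \<le> 0"
  proof (rule tendsto_lowerbound)
    show "((\<lambda>\<eta>. K * \<eta> * B) \<longlongrightarrow> 0) (at_right 0)"
      by (auto intro!: tendsto_eq_intros)
    show "\<forall>\<^sub>F \<eta> in at_right 0. \<bar>?I\<bar> \<le> K * \<eta> * B"
      using eventually_at_right_less[of "0::real"] by eventually_elim (rule lim)
  qed simp
  then show ?thesis by simp
qed

text \<open>
  The exponential law lives on the half line, and the Stein equation is available only there; it
  may be evaluated at \<open>W\<close> because \<open>W \<ge> 0\<close> almost surely.
\<close>

lemma stop_loss_identity:
  fixes g g' :: "real \<Rightarrow> real"
  assumes deriv: "\<And>w. (g has_real_derivative g' w) (at w)"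
    and lip: "K-lipschitz_on UNIV g'"
    and g: "\<And>w. g w \<in> {-1..0}" and g': "\<And>w. g' w \<in> {-1..0}"
    and stein: "\<And>w. 0 \<le> w \<Longrightarrow> w * g' w + (1 - w) * g w = max (w - a) 0 - exp (- a)"
  shows "\<Lambda> * ((LINT \<omega>|M. max (W \<omega> - a) 0) - exp (- a)) =
    - (LINT \<omega>|M. g (W \<omega>) * E \<omega> + g' (W \<omega>) * (E' \<omega> / 2))"
proof -
  note [measurable] = borel_measurable_DERIV[OF deriv] borel_measurable_lipschitz[OF lip]
  have gb: "\<bar>g w\<bar> \<le> 1" "\<bar>g' w\<bar> \<le> 1" for w using g[of w] g'[of w] by auto
  have int: "integrable M (\<lambda>\<omega>. g (W \<omega>) * X \<omega>)" "integrable M (\<lambda>\<omega>. g' (W \<omega>) * X \<omega>)"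
    if "integrable M X" for X
    using that gb by (auto intro!: bounded_mult_integrable)
  have "2 * (LINT \<omega>|M. g (W \<omega>) * (\<Lambda> * (1 - W \<omega>) + E \<omega>) + g' (W \<omega>) * (\<Lambda> * W \<omega> + E' \<omega> / 2)) = 0"
  proof -
    have "integrable M (\<lambda>\<omega>. \<Lambda> * W \<omega> + E' \<omega> / 2)"
      using W_integrable error_integrable by simp
    then have "2 * (LINT \<omega>|M. g (W \<omega>) * (\<Lambda> * (1 - W \<omega>) + E \<omega>) + g' (W \<omega>) * (\<Lambda> * W \<omega> + E' \<omega> / 2)) =
      2 * (LINT \<omega>|M. g (W \<omega>) * (\<Lambda> * (1 - W \<omega>) + E \<omega>)) +
      (LINT \<omega>|M. 2 * (g' (W \<omega>) * (\<Lambda> * W \<omega> + E' \<omega> / 2)))"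
      using int(1)[OF drift_integrable] int(2) by simp
    also have "(\<lambda>\<omega>. 2 * (g' (W \<omega>) * (\<Lambda> * W \<omega> + E' \<omega> / 2))) = (\<lambda>\<omega>. g' (W \<omega>) * (2 * \<Lambda> * W \<omega> + E' \<omega>))"
      by (auto simp: algebra_simps)
    finally show ?thesis using generator_identity[OF deriv lip g g'] by simp
  qed
  then have "0 = (LINT \<omega>|M. g (W \<omega>) * (\<Lambda> * (1 - W \<omega>) + E \<omega>) + g' (W \<omega>) * (\<Lambda> * W \<omega> + E' \<omega> / 2))"
    by simp
  also have "\<dots> = (LINT \<omega>|M. \<Lambda> * (max (W \<omega> - a) 0 - exp (- a)) +
      (g (W \<omega>) * E \<omega> + g' (W \<omega>) * (E' \<omega> / 2)))"
  proof (rule integral_cong_AE)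
    show "AE \<omega> in M. g (W \<omega>) * (\<Lambda> * (1 - W \<omega>) + E \<omega>) + g' (W \<omega>) * (\<Lambda> * W \<omega> + E' \<omega> / 2) =
      \<Lambda> * (max (W \<omega> - a) 0 - exp (- a)) + (g (W \<omega>) * E \<omega> + g' (W \<omega>) * (E' \<omega> / 2))"
      using W_nonneg
    proof eventually_elim
      case (elim \<omega>)
      show ?case unfolding stein[OF elim, symmetric] by (simp add: algebra_simps)
    qed
  qed measurable
  also have "\<dots> = (LINT \<omega>|M. \<Lambda> * (max (W \<omega> - a) 0 - exp (- a))) +
      (LINT \<omega>|M. g (W \<omega>) * E \<omega> + g' (W \<omega>) * (E' \<omega> / 2))"
    using W_integrable error_integrable int
    by (intro Bochner_Integration.integral_add) auto
  also have "(LINT \<omega>|M. \<Lambda> * (max (W \<omega> - a) 0 - exp (- a))) =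
      \<Lambda> * ((LINT \<omega>|M. max (W \<omega> - a) 0) - exp (- a))"
    using W_integrable by (simp add: prob_space)
  finally show ?thesis by simp
qed

text \<open>
  Estimating the two stop-loss errors separately would cost twice \<open>LINT \<omega>|M. \<bar>E \<omega>\<bar>\<close>, more than
  the factor \<open>1 + 2 / exp 1\<close> permits. Both Stein solutions take values in \<open>{-1..0}\<close>, as do their
  derivatives, so the differences are bounded by \<open>1\<close> and the factor is \<open>1\<close>.
\<close>

lemma stop_loss_difference_bound:
  assumes "0 \<le> a" "0 \<le> b"
  shows "\<bar>\<Lambda> * (((LINT \<omega>|M. max (W \<omega> - a) 0) - (LINT \<omega>|M. max (W \<omega> - b) 0)) - (exp (- a) - exp (- b)))\<bar>
    \<le> (LINT \<omega>|M. \<bar>E \<omega>\<bar>) + (LINT \<omega>|M. \<bar>E' \<omega>\<bar>) / 2"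
proof -
  obtain g g' K where g: "\<And>w. (g has_real_derivative g' w) (at w)"
    "K-lipschitz_on UNIV g'" "\<And>w. g w \<in> {-1..0}" "\<And>w. g' w \<in> {-1..0}"
    "\<And>w. 0 \<le> w \<Longrightarrow> w * g' w + (1 - w) * g w = max (w - a) 0 - exp (- a)"
    using exponential_stein_solution[OF assms(1)] by blast
  obtain h h' L where h: "\<And>w. (h has_real_derivative h' w) (at w)"
    "L-lipschitz_on UNIV h'" "\<And>w. h w \<in> {-1..0}" "\<And>w. h' w \<in> {-1..0}"
    "\<And>w. 0 \<le> w \<Longrightarrow> w * h' w + (1 - w) * h w = max (w - b) 0 - exp (- b)"
    using exponential_stein_solution[OF assms(2)] by blast
  note [measurable] = borel_measurable_DERIV[OF g(1)] borel_measurable_lipschitz[OF g(2)]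
    borel_measurable_DERIV[OF h(1)] borel_measurable_lipschitz[OF h(2)]
  have gb: "\<bar>g w\<bar> \<le> 1" "\<bar>g' w\<bar> \<le> 1" "\<bar>h w\<bar> \<le> 1" "\<bar>h' w\<bar> \<le> 1" for w
    using g(3,4)[of w] h(3,4)[of w] by auto
  have int: "integrable M (\<lambda>\<omega>. g (W \<omega>) * E \<omega> + g' (W \<omega>) * (E' \<omega> / 2))"
    "integrable M (\<lambda>\<omega>. h (W \<omega>) * E \<omega> + h' (W \<omega>) * (E' \<omega> / 2))"
    using error_integrable gb by (auto intro!: Bochner_Integration.integrable_add bounded_mult_integrable)
  have "\<Lambda> * (((LINT \<omega>|M. max (W \<omega> - a) 0) - (LINT \<omega>|M. max (W \<omega> - b) 0)) - (exp (- a) - exp (- b)))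
    = \<Lambda> * ((LINT \<omega>|M. max (W \<omega> - a) 0) - exp (- a)) - \<Lambda> * ((LINT \<omega>|M. max (W \<omega> - b) 0) - exp (- b))"
    by (simp add: algebra_simps)
  also have "\<dots> = (LINT \<omega>|M. h (W \<omega>) * E \<omega> + h' (W \<omega>) * (E' \<omega> / 2)) - (LINT \<omega>|M. g (W \<omega>) * E \<omega> + g' (W \<omega>) * (E' \<omega> / 2))"
    by (simp only: stop_loss_identity[OF g] stop_loss_identity[OF h])
  also have "\<dots> = (LINT \<omega>|M. (h (W \<omega>) * E \<omega> + h' (W \<omega>) * (E' \<omega> / 2)) - (g (W \<omega>) * E \<omega> + g' (W \<omega>) * (E' \<omega> / 2)))"
    by (rule Bochner_Integration.integral_diff[OF int(2,1), symmetric])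
  finally have "\<bar>\<Lambda> * (((LINT \<omega>|M. max (W \<omega> - a) 0) - (LINT \<omega>|M. max (W \<omega> - b) 0)) - (exp (- a) - exp (- b)))\<bar>
    = \<bar>LINT \<omega>|M. (h (W \<omega>) * E \<omega> + h' (W \<omega>) * (E' \<omega> / 2)) - (g (W \<omega>) * E \<omega> + g' (W \<omega>) * (E' \<omega> / 2))\<bar>"
    by simp
  also have "\<dots> \<le> (LINT \<omega>|M. \<bar>E \<omega>\<bar> + \<bar>E' \<omega>\<bar> / 2)"
  proof (rule integral_abs_le_integral)
    fix \<omega>
    have "(h (W \<omega>) * E \<omega> + h' (W \<omega>) * (E' \<omega> / 2)) - (g (W \<omega>) * E \<omega> + g' (W \<omega>) * (E' \<omega> / 2))
      = (h (W \<omega>) - g (W \<omega>)) * E \<omega> + (h' (W \<omega>) - g' (W \<omega>)) * (E' \<omega> / 2)"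
      by (simp add: algebra_simps)
    also have "\<bar>\<dots>\<bar> \<le> \<bar>h (W \<omega>) - g (W \<omega>)\<bar> * \<bar>E \<omega>\<bar> + \<bar>h' (W \<omega>) - g' (W \<omega>)\<bar> * \<bar>E' \<omega> / 2\<bar>"
      unfolding abs_mult[symmetric] by (rule abs_triangle_ineq)
    also have "\<dots> \<le> 1 * \<bar>E \<omega>\<bar> + 1 * \<bar>E' \<omega> / 2\<bar>"
      using g(3,4)[of "W \<omega>"] h(3,4)[of "W \<omega>"] by (intro add_mono mult_right_mono) auto
    finally show "\<bar>(h (W \<omega>) * E \<omega> + h' (W \<omega>) * (E' \<omega> / 2)) - (g (W \<omega>) * E \<omega> + g' (W \<omega>) * (E' \<omega> / 2))\<bar>
        \<le> \<bar>E \<omega>\<bar> + \<bar>E' \<omega>\<bar> / 2" by simp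
  qed (use int error_integrable in auto)
  also have "\<dots> = (LINT \<omega>|M. \<bar>E \<omega>\<bar>) + (LINT \<omega>|M. \<bar>E' \<omega>\<bar>) / 2"
    using error_integrable by simp
  finally show ?thesis .
qed

end

section \<open>Ramps against the exponential law\<close>

lemma exp_minus_le_quadratic:
  assumes "0 \<le> (d::real)"
  shows "exp (- d) \<le> 1 - d + d\<^sup>2 / 2"
proof -
  have "(\<lambda>x. 1 - x + x\<^sup>2 / 2 - exp (- x)) 0 \<le> (\<lambda>x. 1 - x + x\<^sup>2 / 2 - exp (- x)) d"
  proof (rule DERIV_nonneg_imp_nondecreasing[OF assms])
    fix x :: real
    have "((\<lambda>x. 1 - x + x\<^sup>2 / 2 - exp (- x)) has_real_derivative - 1 + x + exp (- x)) (at x)"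
      by (auto intro!: derivative_eq_intros)
    moreover have "0 \<le> - 1 + x + exp (- x)" using exp_ge_add_one_self[of "- x"] by simp
    ultimately show "\<exists>y. ((\<lambda>x. 1 - x + x\<^sup>2 / 2 - exp (- x)) has_real_derivative y) (at x) \<and> 0 \<le> y"
      by blast
  qed
  then show ?thesis by simp
qed

lemma one_plus_mult_exp_minus_ge:
  assumes "0 \<le> (d::real)"
  shows "1 - d\<^sup>2 / 2 \<le> (1 + d) * exp (- d)"
proof -
  have "(\<lambda>x. (1 + x) * exp (- x) + x\<^sup>2 / 2) 0 \<le> (\<lambda>x. (1 + x) * exp (- x) + x\<^sup>2 / 2) d"
  proof (rule DERIV_nonneg_imp_nondecreasing[OF assms])
    fix x :: real assume "0 \<le> x"
    have "((\<lambda>x. (1 + x) * exp (- x) + x\<^sup>2 / 2) has_real_derivative x * (1 - exp (- x))) (at x)"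
      by (auto intro!: derivative_eq_intros simp: algebra_simps)
    moreover have "0 \<le> x * (1 - exp (- x))" using \<open>0 \<le> x\<close> by simp
    ultimately show "\<exists>y. ((\<lambda>x. (1 + x) * exp (- x) + x\<^sup>2 / 2) has_real_derivative y) (at x) \<and> 0 \<le> y"
      by blast
  qed
  then show ?thesis by simp
qed

text \<open>
  The ramp that decreases from \<open>1\<close> at \<open>s\<close> to \<open>0\<close> at \<open>s + \<delta>\<close> exceeds the indicator of
  \<open>{..s}\<close> by a triangle of area \<open>\<delta> / 2\<close>, and the exponential density is at most \<open>1\<close>. The
  inequality is this fact multiplied by \<open>\<delta>\<close>, with the expectation of the ramp written in terms
  of the stop-loss means \<open>exp (- s)\<close> and \<open>exp (- (s + \<delta>))\<close>.
\<close>

lemma exponential_right_ramp: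
  fixes s \<delta> :: real
  assumes "0 \<le> s" "0 < \<delta>"
  shows "\<delta> * exp (- s) - \<delta>\<^sup>2 / 2 \<le> exp (- s) - exp (- (s + \<delta>))"
proof -
  have "exp (- s) * (\<delta> - 1 + exp (- \<delta>)) \<le> exp (- s) * (\<delta>\<^sup>2 / 2)"
    using exp_minus_le_quadratic[of \<delta>] assms by (intro mult_left_mono) auto
  also have "\<dots> \<le> 1 * (\<delta>\<^sup>2 / 2)"
    using assms by (intro mult_right_mono) auto
  finally have "exp (- s) * (\<delta> - 1 + exp (- \<delta>)) \<le> \<delta>\<^sup>2 / 2" by simp
  moreover have "exp (- (s + \<delta>)) = exp (- s) * exp (- \<delta>)" by (simp flip: exp_add)
  ultimately show ?thesis by (simp add: algebra_simps)
qed

text \<open>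
  The counterpart for the ramp that ends at \<open>s\<close>. When \<open>s < \<delta>\<close> the ramp would start at a
  negative point; the part on the positive half line has height \<open>s / \<delta>\<close> at \<open>0\<close>, which is why
  the left end is cut off at \<open>0\<close>. That case reduces to \<open>\<delta> = s\<close> because
  \<open>\<delta> * (1 - exp (- s)) - \<delta>\<^sup>2 / 2\<close> decreases in \<open>\<delta>\<close> beyond \<open>s\<close>.
\<close>

lemma exponential_left_ramp:
  fixes s \<delta> :: real
  assumes "0 \<le> s" "0 < \<delta>"
  defines "a \<equiv> max (s - \<delta>) 0"
  shows "\<delta> * (1 - exp (- s)) - \<delta>\<^sup>2 / 2 \<le> (s - a) - (exp (- a) - exp (- s))"
proof -
  define d where "d = s - a"
  have d: "0 \<le> d" "d \<le> s" "d \<le> \<delta>" using assms by (auto simp: d_def)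
  have ea: "exp (- a) = exp (- s) * exp d" by (simp add: d_def flip: exp_add)
  have base: "d * (1 - exp (- s)) - d\<^sup>2 / 2 \<le> (s - a) - (exp (- a) - exp (- s))"
  proof -
    have "exp (- s) * (exp d - 1 - d) \<le> exp (- d) * (exp d - 1 - d)"
    proof (rule mult_right_mono)
      show "0 \<le> exp d - 1 - d" using exp_ge_add_one_self[of d] by linarith
    qed (use d in simp)
    also have "\<dots> = 1 - (1 + d) * exp (- d)" by (simp add: algebra_simps flip: exp_add)
    also have "\<dots> \<le> d\<^sup>2 / 2" using one_plus_mult_exp_minus_ge[of d] d by simp
    finally show ?thesis unfolding ea d_def[symmetric] by (simp add: algebra_simps)
  qed
  have "\<delta> * (1 - exp (- s)) - \<delta>\<^sup>2 / 2 \<le> d * (1 - exp (- s)) - d\<^sup>2 / 2"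
  proof (cases "d = \<delta>")
    case False
    then have "d = s" using assms by (auto simp: d_def max_def split: if_splits)
    have "1 - exp (- s) \<le> (\<delta> + d) / 2"
      using exp_ge_add_one_self[of "- s"] d \<open>d = s\<close> by auto
    then have "(\<delta> - d) * (1 - exp (- s)) \<le> (\<delta> - d) * ((\<delta> + d) / 2)"
      using d by (intro mult_left_mono) auto
    then show ?thesis by (simp add: algebra_simps power2_eq_square diff_divide_distrib add_divide_distrib)
  qed simp
  with base show ?thesis by linarith
qed

section \<open>The Kolmogorov bound\<close>

context exponential_exchangeable_family
begin

text \<open>
  The indicator of \<open>{..s}\<close> lies between two ramps of slope \<open>- 1 / \<delta>\<close>, one ending and one starting
  at \<open>s\<close>. Each ramp is, up to constants, a difference of two stop-loss functions divided by
  \<open>\<delta>\<close>, whose mean \<open>stop_loss_difference_bound\<close> compares with the exponential one.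
\<close>

lemma cdf_bound:
  assumes s: "0 \<le> s" and \<delta>: "0 < \<delta>" and \<Lambda>: "0 < \<Lambda>"
  shows "\<bar>prob {\<omega> \<in> space M. W \<omega> \<le> s} - (1 - exp (- s))\<bar> \<le>
    1 / (\<Lambda> * \<delta>) * ((LINT \<omega>|M. \<bar>E \<omega>\<bar>) + (LINT \<omega>|M. \<bar>E' \<omega>\<bar>) / 2) + \<delta> / 2"
proof -
  define err where "err = ((LINT \<omega>|M. \<bar>E \<omega>\<bar>) + (LINT \<omega>|M. \<bar>E' \<omega>\<bar>) / 2) / \<Lambda>"
  define m where "m a = (LINT \<omega>|M. max (W \<omega> - a) 0)" for a
  define P where "P = prob {\<omega> \<in> space M. W \<omega> \<le> s}"
  define a where "a = max (s - \<delta>) 0"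
  have diff: "\<bar>(m x - m y) - (exp (- x) - exp (- y))\<bar> \<le> err" if "0 \<le> x" "0 \<le> y" for x y
    using stop_loss_difference_bound[OF that] \<Lambda>
    by (simp add: abs_mult err_def m_def pos_le_divide_eq mult.commute)
  have m_int: "integrable M (\<lambda>\<omega>. max (W \<omega> - x) 0)" for x
    using W_integrable by auto
  have P_eq: "P = (LINT \<omega>|M. indicator {..s} (W \<omega>))"
  proof -
    have "(LINT \<omega>|M. indicator {..s} (W \<omega>)) = (LINT \<omega>|M. indicator {\<omega> \<in> space M. W \<omega> \<le> s} \<omega> :: real)"
      by (rule Bochner_Integration.integral_cong) (auto simp: indicator_def)
    then show ?thesis by (simp add: P_def)
  qed
  have P_int: "integrable M (\<lambda>\<omega>. indicator {..s} (W \<omega>) :: real)"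
    by (rule integrable_const_bound[where B = 1]) (auto simp: indicator_def)
  have "\<delta> * P = (LINT \<omega>|M. \<delta> * indicator {..s} (W \<omega>))" by (simp add: P_eq)
  also have "\<dots> \<le> (LINT \<omega>|M. \<delta> - (max (W \<omega> - s) 0 - max (W \<omega> - (s + \<delta>)) 0))"
    using \<delta> P_int m_int by (intro integral_mono) (auto simp: indicator_def max_def)
  also have "\<dots> = \<delta> - (m s - m (s + \<delta>))"
    using m_int by (simp add: m_def prob_space)
  also have "\<dots> \<le> \<delta> * (1 - exp (- s)) + \<delta>\<^sup>2 / 2 + err"
    using diff[of s "s + \<delta>"] exponential_right_ramp[OF s \<delta>] s \<delta> by (simp add: algebra_simps)
  finally have upper: "\<delta> * P \<le> \<delta> * (1 - exp (- s)) + \<delta>\<^sup>2 / 2 + err" .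
  have "\<delta> * (1 - exp (- s)) - \<delta>\<^sup>2 / 2 - err \<le> (s - a) - (m a - m s)"
    using diff[of a s] exponential_left_ramp[OF s \<delta>] s by (simp add: a_def algebra_simps)
  also have "\<dots> = (LINT \<omega>|M. (s - a) - (max (W \<omega> - a) 0 - max (W \<omega> - s) 0))"
    using m_int by (simp add: m_def prob_space)
  also have "\<dots> \<le> (LINT \<omega>|M. \<delta> * indicator {..s} (W \<omega>))"
  proof (rule integral_mono_AE)
    show "AE \<omega> in M. (s - a) - (max (W \<omega> - a) 0 - max (W \<omega> - s) 0) \<le> \<delta> * indicator {..s} (W \<omega>)"
      using s \<delta> by (auto simp: indicator_def max_def a_def)
  qed (use P_int m_int in auto)
  also have "\<dots> = \<delta> * P" by (simp add: P_eq)
  finally have lower: "\<delta> * (1 - exp (- s)) - \<delta>\<^sup>2 / 2 - err \<le> \<delta> * P" .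
  have "\<bar>\<delta> * (P - (1 - exp (- s)))\<bar> \<le> err + \<delta>\<^sup>2 / 2"
    using upper lower by (simp add: right_diff_distrib abs_le_iff)
  then have "\<bar>P - (1 - exp (- s))\<bar> \<le> (err + \<delta>\<^sup>2 / 2) / \<delta>"
    using \<delta> by (simp add: abs_mult pos_le_divide_eq mult.commute)
  also have "\<dots> = err / \<delta> + \<delta> / 2"
    using \<delta> by (simp add: add_divide_distrib power2_eq_square)
  finally show ?thesis by (simp add: P_def err_def mult.commute)
qed

end

theorem theorem5p3:
  fixes M :: "'a measure" and N :: "'b measure" and F :: "'a measure"
    and Z :: "'b \<Rightarrow> real" and W :: "'a \<Rightarrow> real" and Wt :: "real \<Rightarrow> 'a \<Rightarrow> real"
    and E E' :: "'a \<Rightarrow> real" and \<Lambda> :: real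
  assumes "prob_space N" and "distributed N lborel Z (exponential_density 1)"
    and "prob_space M"
    and "W \<in> borel_measurable M" and "AE \<omega> in M. 0 \<le> W \<omega>"
    and "integrable M (\<lambda>\<omega>. (W \<omega>)\<^sup>2)"
    and "\<And>t. 0 < t \<Longrightarrow> exchangeable_pair M W (Wt t)"
    and "subalgebra M F" and "sets (vimage_algebra (space M) W borel) \<subseteq> sets F"
    and "0 < \<Lambda>"
    and "E \<in> borel_measurable F" and "E' \<in> borel_measurable F"
    and "random_bigo_sq M (\<lambda>t \<omega>. real_cond_exp M F (\<lambda>\<omega>. Wt t \<omega> - W \<omega>) \<omega>
           - (\<Lambda> * t * (1 - W \<omega>) + t * E \<omega>))"
    and "random_bigo_sq M (\<lambda>t \<omega>. real_cond_exp M F (\<lambda>\<omega>. (Wt t \<omega> - W \<omega>)\<^sup>2) \<omega>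
           - (2 * \<Lambda> * t * W \<omega> + t * E' \<omega>))"
    and "\<And>\<rho>. 0 < \<rho> \<Longrightarrow>
           ((\<lambda>t. 1 / t * (LINT \<omega>|M. \<bar>Wt t \<omega> - W \<omega>\<bar>\<^sup>2 *
                indicator {\<omega>. \<bar>Wt t \<omega> - W \<omega>\<bar>\<^sup>2 > \<rho>} \<omega>)) \<longlongrightarrow> 0) (at_right 0)"
  shows "\<forall>\<delta>>0. kolmogorov_dist M W N Z \<le>
           1 / (\<Lambda> * \<delta>) * (2 * (LINT \<omega>|M. \<bar>E' \<omega>\<bar>) + (1 + 2 / exp 1) * (LINT \<omega>|M. \<bar>E \<omega>\<bar>))
           + \<delta> / 2"
proof (intro allI impI)
  fix \<delta> :: real assume \<delta>: "0 < \<delta>"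
  interpret N: prob_space N by fact
  interpret M: prob_space M by fact
  have W_F: "W \<in> borel_measurable F"
  proof -
    have "W \<in> borel_measurable (vimage_algebra (space M) W borel)"
      by (rule measurable_vimage_algebra1) simp
    moreover have "space F = space M" using assms(8) by (simp add: subalgebra_def)
    ultimately show ?thesis
      using measurable_mono[of borel borel "vimage_algebra (space M) W borel" F] assms(9) by auto
  qed
  interpret exponential_exchangeable_family M F W Wt E E' \<Lambda>
  proof unfold_locales
    show "random_bigo_sq M (\<lambda>t \<omega>. real_cond_exp M F (\<lambda>\<omega>. Wt t \<omega> - W \<omega>) \<omega>
        - t * (\<Lambda> * (1 - W \<omega>) + E \<omega>))"
      using assms(13) by (simp add: algebra_simps)
    show "random_bigo_sq M (\<lambda>t \<omega>. real_cond_exp M F (\<lambda>\<omega>. (Wt t \<omega> - W \<omega>)\<^sup>2) \<omega>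
        - t * (2 * \<Lambda> * W \<omega> + E' \<omega>))"
      using assms(14) by (simp add: algebra_simps)
  qed (use assms W_F in auto)
  let ?R = "1 / (\<Lambda> * \<delta>) * (2 * (LINT \<omega>|M. \<bar>E' \<omega>\<bar>) + (1 + 2 / exp 1) * (LINT \<omega>|M. \<bar>E \<omega>\<bar>)) + \<delta> / 2"
  have pos: "0 \<le> (LINT \<omega>|M. \<bar>E' \<omega>\<bar>)" "0 \<le> (LINT \<omega>|M. \<bar>E \<omega>\<bar>)" by auto
  have weaken: "1 / (\<Lambda> * \<delta>) * ((LINT \<omega>|M. \<bar>E \<omega>\<bar>) + (LINT \<omega>|M. \<bar>E' \<omega>\<bar>) / 2) + \<delta> / 2 \<le> ?R"
  proof -
    have "1 * (LINT \<omega>|M. \<bar>E \<omega>\<bar>) \<le> (1 + 2 / exp 1) * (LINT \<omega>|M. \<bar>E \<omega>\<bar>)"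
      using pos by (intro mult_right_mono) auto
    then have "(LINT \<omega>|M. \<bar>E \<omega>\<bar>) + (LINT \<omega>|M. \<bar>E' \<omega>\<bar>) / 2
        \<le> 2 * (LINT \<omega>|M. \<bar>E' \<omega>\<bar>) + (1 + 2 / exp 1) * (LINT \<omega>|M. \<bar>E \<omega>\<bar>)"
      using pos by linarith
    then show ?thesis
      using \<delta> \<open>0 < \<Lambda>\<close> by (intro add_right_mono mult_left_mono) auto
  qed
  show "kolmogorov_dist M W N Z \<le> ?R"
    unfolding kolmogorov_dist_def
  proof (rule cSUP_least)
    fix s :: real
    show "\<bar>\<P>(\<omega> in M. W \<omega> \<le> s) - \<P>(\<omega> in N. Z \<omega> \<le> s)\<bar> \<le> ?R"
    proof (cases "0 \<le> s")
      case True
      have "\<P>(\<omega> in N. Z \<omega> \<le> s) = 1 - exp (- s)"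
        using N.exponential_distributedD_le[OF assms(2) True] by simp
      then show ?thesis
        using cdf_bound[OF True \<delta> \<open>0 < \<Lambda>\<close>] weaken by simp
    next
      case False
      have "\<P>(\<omega> in M. W \<omega> \<le> s) = 0"
        using W_nonneg False by (intro M.prob_eq_0_AE) auto
      moreover have "\<P>(\<omega> in N. Z \<omega> \<le> s) = 0"
      proof -
        have [measurable]: "Z \<in> borel_measurable N" using distributed_measurable[OF assms(2)] by simp
        have "\<P>(\<omega> in N. Z \<omega> \<le> s) \<le> \<P>(\<omega> in N. Z \<omega> \<le> 0)"
          using False by (intro N.finite_measure_mono) auto
        also have "\<dots> = 0"
          using N.exponential_distributedD_le[OF assms(2), of 0] by simp
        finally show ?thesis by (simp add: measure_le_0_iff)
      qed
      moreover have "0 \<le> ?R" using pos \<delta> \<open>0 < \<Lambda>\<close> by simp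
      ultimately show ?thesis by simp
    qed
  qed simp
qed

end
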